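(* Let $N\ge 1$ and let $\mathbf v_1=(s_1,t_1),\dots,\mathbf v_N=(s_N,t_N)\in\mathbb Z^2$ be fixed vectors whose second components $t_1,\dots,t_N$ are pairwise distinct. Let $M:=\max_{1\le j\le N}\|\mathbf v_j\|_\infty$. For a prime $p$ let \[ \mathcal G_N(p):=\bigcap_{j=1}^N\big\{(a,b)\in\mathbb Z^2: 0\le a\le p-1,\ 1\le b\le p-1,\ 0\le a+s_j\le p-1,\ 1\le b+t_j\le p-1\big\}, \] and for $(a,b)\in\mathcal G_N(p)$ let \[ \mathbf x_{a,b}(p):=\frac1p\big(A_{a+s_1,b+t_1},\dots,A_{a+s_N,b+t_N}\big)\in[0,1]^N . \] Then for every permutation $\sigma$ of $\{1,\dots,N\}$, \[ \#\big\{(a,b)\in\mathcal G_N(p): \mathbf x_{a,b}(p)\in T(\sigma,N)\big\}=\frac{p^2}{N!}+O_{M,N}\Big(p^{(2N+1)/(N+1)}(\log p)^{N/(N+1)}\Big), \] where the implied constant depends only on $M$ and $N$.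
   Context: For a prime $p$ and an integer $n$ with $\gcd(n,p)=1$, $\mathfrak q_p(n)$ denotes the unique representative in $\{0,1,\dots,p-1\}$ of the integer $\frac{n^{p-1}-1}{p}$ modulo $p$. The Fermat quotient matrix has entries $A_{a,b}:=\mathfrak q_p(ap+b)$ for $0\le a\le p-1$, $1\le b\le p-1$. For a permutation $\sigma$ of $\{1,\dots,N\}$, $T(\sigma,N):=\{(x_1,\dots,x_N)\in[0,1]^N: x_{\sigma(1)}<x_{\sigma(2)}<\cdots<x_{\sigma(N)}\}$. *)

theory Defs
  imports Complex_Main "HOL-Library.FuncSet" "HOL-Combinatorics.Permutations"
    "HOL-Computational_Algebra.Primes"
begin

text \<open>The division is exact for a prime p not dividing n, by Fermat's little theorem; the
  definition is only meaningful for such p and n.\<close>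

definition fermat_quotient :: "nat \<Rightarrow> int \<Rightarrow> int" where
  "fermat_quotient p n = ((n ^ (p - 1) - 1) div int p) mod int p"

definition fermat_matrix :: "nat \<Rightarrow> int \<Rightarrow> int \<Rightarrow> int" where
  "fermat_matrix p a b = fermat_quotient p (a * int p + b)"

definition sup_norm :: "int \<times> int \<Rightarrow> int" where
  "sup_norm w = max \<bar>fst w\<bar> \<bar>snd w\<bar>"

text \<open>A tuple of length N is a function on the index set \<open>{1..N}\<close>; points of \<open>[0,1]\<^sup>N\<close>
  are extensional functions on \<open>{1..N}\<close>.\<close>

definition admissible_positions :: "nat \<Rightarrow> (nat \<Rightarrow> int \<times> int) \<Rightarrow> nat \<Rightarrow> (int \<times> int) set" where
  "admissible_positions N v p =
     (\<Inter>j\<in>{1..N}. {(a, b). 0 \<le> a \<and> a \<le> int p - 1 \<and> 1 \<le> b \<and> b \<le> int p - 1 \<and>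
        0 \<le> a + fst (v j) \<and> a + fst (v j) \<le> int p - 1 \<and>
        1 \<le> b + snd (v j) \<and> b + snd (v j) \<le> int p - 1})"

definition pattern_point ::
  "nat \<Rightarrow> (nat \<Rightarrow> int \<times> int) \<Rightarrow> nat \<Rightarrow> int \<Rightarrow> int \<Rightarrow> nat \<Rightarrow> real" where
  "pattern_point N v p a b =
     (\<lambda>j\<in>{1..N}. real_of_int (fermat_matrix p (a + fst (v j)) (b + snd (v j))) / real p)"

definition order_simplex :: "(nat \<Rightarrow> nat) \<Rightarrow> nat \<Rightarrow> (nat \<Rightarrow> real) set" where
  "order_simplex \<sigma> N =
     {x \<in> {1..N} \<rightarrow>\<^sub>E {0..1}. \<forall>i\<in>{1..<N}. x (\<sigma> i) < x (\<sigma> (i + 1))}"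

end

theory Submission
  imports Defs "HOL-Number_Theory.Residues" "HOL-Computational_Algebra.Polynomial"
begin

text \<open>Modulo \<open>p\<close> the entry \<open>A\<^bsub>a+s,b+t\<^esub>\<close> is affine in \<open>a\<close> with slope
  \<open>- 1 / (b + t)\<close>. Summing over a full period of \<open>a\<close>, the exponential sum with frequency
  \<open>c \<noteq> 0\<close> keeps only those \<open>b\<close> with \<open>\<Sum>\<^sub>j c\<^sub>j / (b + t\<^sub>j) = 0\<close> modulo \<open>p\<close>; there are at most
  \<open>N\<close> of them because the \<open>t\<^sub>j\<close> are distinct, so the sum is at most \<open>N p\<close>.

  It suffices to bound each count from below by \<open>p\<^sup>2 / N! - E\<close>, since the counts over all
  \<open>N!\<close> permutations add up to at most \<open>p\<^sup>2\<close>. For the lower bound, let \<open>Z\<close> be the set of chains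
  ordered by \<open>\<sigma>\<close> with gaps at least \<open>W\<close>, and \<open>B\<close> the cube of side \<open>W\<close>: then \<open>Z + B\<close> consists of
  correctly ordered points. Weighting by the convolution of the indicators of \<open>Z\<close> and \<open>B\<close>,
  rather than by a union of boxes, makes the Fourier side absolutely summable
  by Parseval, which avoids the discrepancy inequality of Erdos-Turan-Koksma. The error is
  \<open>O(p W + p (p / W)\<^sup>N)\<close>, and \<open>W\<close> is chosen near \<open>p\<close> to the power \<open>N / (N + 1)\<close>.\<close>

section \<open>Fermat quotients and roots modulo a prime\<close>

text \<open>A Fermat quotient involves one division by \<open>p\<close>, so powers must be known
  modulo \<open>p^2\<close>; taking \<open>x = a * p\<close> here gives exactly that
  precision.\<close>

lemma square_dvd_binomial_remainder:
  fixes m x :: int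
  shows "x\<^sup>2 dvd (m + x) ^ n - m ^ n - int n * x * m ^ (n - 1)"
proof (induction n)
  case (Suc n)
  then obtain k where k: "(m + x) ^ n = m ^ n + int n * x * m ^ (n - 1) + x\<^sup>2 * k"
    by (auto simp: dvd_def algebra_simps)
  \<comment> \<open>For \<open>n = 0\<close> the exponent \<open>n - 1\<close> truncates to 0, and
    the factor \<open>int n\<close> makes both sides vanish.\<close>
  have m: "int n * m ^ (n - 1) * m = int n * m ^ n"
    by (cases n) simp_all
  have "(m + x) ^ Suc n - m ^ Suc n - int (Suc n) * x * m ^ (Suc n - 1)
      = x * (int n * m ^ (n - 1) * m - int n * m ^ n) + x\<^sup>2 * (int n * m ^ (n - 1) + k * (m + x))"
    by (simp add: k algebra_simps power2_eq_square)
  also have "\<dots> = x\<^sup>2 * (int n * m ^ (n - 1) + k * (m + x))"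
    by (simp only: m) simp
  finally show ?case
    by simp
qed simp

lemma prime_dvd_power_minus_one:
  fixes n :: int
  assumes "prime p" "\<not> int p dvd n"
  shows "int p dvd n ^ (p - 1) - 1"
proof -
  define a where "a = nat (n mod int p)"
  have p: "p > 0"
    using assms(1) prime_gt_0_nat by blast
  have a: "int a = n mod int p"
    using p by (simp add: a_def)
  have "\<not> p dvd a"
    using assms(2) a by (metis dvd_mod_iff dvd_refl int_dvd_int_iff)
  then have "[a ^ (p - 1) = 1] (mod p)"
    using assms(1) fermat_theorem by blast
  then have "[(int a) ^ (p - 1) = 1] (mod int p)"
    by (metis cong_int_iff of_nat_1 of_nat_power)
  moreover have "[n ^ (p - 1) = (int a) ^ (p - 1)] (mod int p)"
    by (intro cong_pow) (simp add: a cong_def)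
  ultimately show ?thesis
    by (meson cong_iff_dvd_diff cong_trans)
qed

text \<open>Expanding \<open>(m + a p)^(p-1)\<close> modulo \<open>p^2\<close> leaves the linear
  term \<open>(p-1) a p m^(p-2)\<close>; dividing by \<open>p\<close> and reducing
  \<open>p - 1\<close> to -1 gives the shift. As \<open>m^(p-2)\<close> inverts \<open>m\<close>
  modulo \<open>p\<close>, the dependence on \<open>a\<close> is affine with slope
  \<open>-1/m\<close>.\<close>

lemma fermat_quotient_shift:
  assumes p: "prime p" and m: "\<not> int p dvd m"
  shows "int p dvd fermat_quotient p (m + a * int p) - (fermat_quotient p m - a * m ^ (p - 2))"
proof -
  have p2: "p \<ge> 2" and p0: "int p \<noteq> 0"
    using p prime_ge_2_nat by force+
  define m' where "m' = m + a * int p"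
  have m': "\<not> int p dvd m'"
    using m by (simp add: m'_def dvd_add_left_iff)
  obtain u where u: "m ^ (p - 1) - 1 = int p * u"
    using prime_dvd_power_minus_one[OF p m] by (auto simp: dvd_def)
  obtain w where w: "m' ^ (p - 1) - 1 = int p * w"
    using prime_dvd_power_minus_one[OF p m'] by (auto simp: dvd_def)
  obtain k where k: "m' ^ (p - 1) - m ^ (p - 1) - int (p - 1) * (a * int p) * m ^ (p - 1 - 1)
      = (a * int p)\<^sup>2 * k"
    using square_dvd_binomial_remainder[of "a * int p" m "p - 1"] unfolding m'_def dvd_def by blast
  have s: "p - 1 - 1 = p - 2" "int (p - 1) = int p - 1"
    using p2 by auto
  have "int p * w - int p * u = m' ^ (p - 1) - m ^ (p - 1)"
    using u w by simp
  also have "\<dots> = (int p - 1) * (a * int p) * m ^ (p - 2) + (a * int p)\<^sup>2 * k"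
    using k unfolding s by linarith
  also have "\<dots> = int p * ((int p - 1) * a * m ^ (p - 2) + a\<^sup>2 * int p * k)"
    by (simp add: algebra_simps power2_eq_square)
  finally have "int p * (w - u) = int p * ((int p - 1) * a * m ^ (p - 2) + a\<^sup>2 * int p * k)"
    by (simp add: algebra_simps)
  then have "w - u = (int p - 1) * a * m ^ (p - 2) + a\<^sup>2 * int p * k"
    using p0 mult_left_cancel by blast
  then have "w - (u - a * m ^ (p - 2)) = int p * (a * m ^ (p - 2) + a\<^sup>2 * k)"
    by (simp add: algebra_simps)
  then have "[w = u - a * m ^ (p - 2)] (mod int p)"
    by (simp add: cong_iff_dvd_diff)
  moreover have "fermat_quotient p m = u mod int p" "fermat_quotient p m' = w mod int p"
    using p0 unfolding fermat_quotient_def u w by simp_all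
  ultimately have "[fermat_quotient p m' = fermat_quotient p m - a * m ^ (p - 2)] (mod int p)"
    by (simp add: cong_def mod_diff_left_eq)
  then show ?thesis
    by (simp add: cong_iff_dvd_diff m'_def)
qed

section \<open>Polynomial roots and sums of reciprocals modulo a prime\<close>

text \<open>Lagrange's argument for integer polynomials: synthetic division by a root
  \<open>r\<close> lowers the degree, and primality passes every other root to the quotient, since
  it is incongruent to \<open>r\<close>. The conclusion concerns all integers \<open>x\<close>
  because it is applied at a point outside the root set.\<close>

lemma dvd_poly_of_many_roots_mod_prime:
  fixes f :: "int poly"
  assumes "prime p" "finite R" "degree f < card R"
    and "\<And>r. r \<in> R \<Longrightarrow> p dvd poly f r"
    and "\<And>r s. r \<in> R \<Longrightarrow> s \<in> R \<Longrightarrow> p dvd r - s \<Longrightarrow> r = s"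
  shows "p dvd poly f x"
  using assms
proof (induction "degree f" arbitrary: f R x)
  case 0
  then obtain c where "f = [:c:]"
    by (metis degree_eq_zeroE)
  moreover obtain r where "r \<in> R"
    using 0 by fastforce
  ultimately show ?case
    using 0 by force
next
  case (Suc n)
  then obtain r where r: "r \<in> R"
    by fastforce
  define g where "g = synthetic_div f r"
  have f: "poly f y = (y - r) * poly g y + poly f r" for y
    using arg_cong[OF synthetic_div_correct'[of r f], of "\<lambda>q. poly q y"]
    by (simp add: g_def algebra_simps)
  have "p dvd poly g x"
  proof (rule Suc.hyps(1))
    show "n = degree g"
      using Suc.hyps by (simp add: g_def degree_synthetic_div)
    then show "degree g < card (R - {r})"
      using Suc.prems r Suc.hyps by simp
    fix s assume s: "s \<in> R - {r}"
    then have "p dvd (s - r) * poly g s"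
      using f[of s] Suc.prems(4)[of s] Suc.prems(4)[OF r] by (simp add: dvd_add_left_iff)
    moreover have "\<not> p dvd s - r"
      using s r Suc.prems(5) by blast
    ultimately show "p dvd poly g s"
      using Suc.prems(1) prime_dvd_mult_iff by blast
  qed (use Suc.prems in auto)
  then show ?case
    using f[of x] Suc.prems(4)[OF r] by simp
qed

text \<open>Modulo \<open>p\<close> the summands are \<open>c j / (b + t j)\<close>. Clearing
  denominators turns the sum into a polynomial \<open>f\<close> of degree at most
  \<open>card I\<close>; more roots than that would make \<open>f\<close> vanish modulo
  \<open>p\<close> everywhere, which its value at \<open>- t i\<close> refutes.\<close>

lemma card_vanishing_power_combination_le:
  fixes c t :: "'a \<Rightarrow> int"
  assumes p: "prime p" and I: "finite I" and i: "i \<in> I" "\<not> int p dvd c i"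
    and t: "\<And>j k. j \<in> I \<Longrightarrow> k \<in> I \<Longrightarrow> j \<noteq> k \<Longrightarrow> \<not> int p dvd t j - t k"
    and R: "R \<subseteq> {0..<int p}"
    and R_t: "\<And>b j. b \<in> R \<Longrightarrow> j \<in> I \<Longrightarrow> \<not> int p dvd b + t j"
    and vanish: "\<And>b. b \<in> R \<Longrightarrow> int p dvd (\<Sum>j\<in>I. c j * (b + t j) ^ (p - 2))"
  shows "card R \<le> card I"
proof (rule ccontr)
  assume "\<not> card R \<le> card I"
  define f where "f = (\<Sum>j\<in>I. smult (c j) (\<Prod>k\<in>I - {j}. [:t k, 1:]))"
  have poly_f: "poly f x = (\<Sum>j\<in>I. c j * (\<Prod>k\<in>I - {j}. x + t k))" for x
    by (simp add: f_def poly_sum poly_prod add.commute)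
  have "degree f \<le> card I"
    unfolding f_def
  proof (rule degree_sum_le[OF I])
    fix j assume "j \<in> I"
    have "degree (\<Prod>k\<in>I - {j}. [:t k, 1:]) \<le> sum (degree \<circ> (\<lambda>k. [:t k, 1:])) (I - {j})"
      by (rule degree_prod_sum_le) (use I in simp)
    also have "\<dots> \<le> card I"
      using I by (simp add: card_Diff_subset_Int)
    finally show "degree (smult (c j) (\<Prod>k\<in>I - {j}. [:t k, 1:])) \<le> card I"
      using degree_smult_le le_trans by blast
  qed
  moreover have "int p dvd poly f b" if b: "b \<in> R" for b
  proof -
    have "[(\<Prod>k\<in>I. b + t k) * (\<Sum>j\<in>I. c j * (b + t j) ^ (p - 2)) = poly f b] (mod int p)"
      unfolding poly_f sum_distrib_left
    proof (rule cong_sum)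
      fix j assume j: "j \<in> I"
      have "Suc (p - 2) = p - 1"
        using prime_ge_2_nat[OF p] by simp
      then have "(b + t j) * (b + t j) ^ (p - 2) = (b + t j) ^ (p - 1)"
        by (metis power_Suc)
      moreover have "(\<Prod>k\<in>I. b + t k) * (c j * (b + t j) ^ (p - 2))
          = c j * (\<Prod>k\<in>I - {j}. b + t k) * ((b + t j) * (b + t j) ^ (p - 2))"
        unfolding prod.remove[OF I j] by (simp only: ac_simps)
      ultimately have "(\<Prod>k\<in>I. b + t k) * (c j * (b + t j) ^ (p - 2))
          = c j * (\<Prod>k\<in>I - {j}. b + t k) * (b + t j) ^ (p - 1)"
        by simp
      moreover have "[(b + t j) ^ (p - 1) = 1] (mod int p)"
        using prime_dvd_power_minus_one[OF p R_t[OF b j]] by (simp add: cong_iff_dvd_diff)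
      ultimately show "[(\<Prod>k\<in>I. b + t k) * (c j * (b + t j) ^ (p - 2))
          = c j * (\<Prod>k\<in>I - {j}. b + t k)] (mod int p)"
        by (metis (no_types) cong_scalar_left mult_1_right)
    qed
    then show ?thesis
      using cong_dvd_iff dvd_mult[OF vanish[OF b]] by (metis (no_types))
  qed
  moreover have "r = s" if "r \<in> R" "s \<in> R" "int p dvd r - s" for r s
    using that(3) subsetD[OF R that(1)] subsetD[OF R that(2)]
    by (intro cong_less_imp_eq_int[of r "int p" s]) (auto simp: cong_iff_dvd_diff)
  moreover have "finite R"
    using R finite_subset by blast
  moreover have "prime (int p)" "degree f < card R"
    using p \<open>\<not> card R \<le> card I\<close> \<open>degree f \<le> card I\<close> by simp_all
  ultimately have "int p dvd poly f (- t i)"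
    using dvd_poly_of_many_roots_mod_prime[of "int p" R f] by (metis (no_types))
  \<comment> \<open>At \<open>- t i\<close> every product belonging to some \<open>j\<close> other
    than \<open>i\<close> contains the zero factor \<open>k = i\<close>, so only the
    \<open>i\<close>-th term survives.\<close>
  also have "poly f (- t i) = c i * (\<Prod>k\<in>I - {i}. t k - t i)"
  proof -
    have "(\<Prod>k\<in>I - {j}. - t i + t k) = 0" if "j \<in> I - {i}" for j
      using I i(1) that by (intro prod_zero) auto
    then have "(\<Sum>j\<in>I - {i}. c j * (\<Prod>k\<in>I - {j}. - t i + t k)) = 0"
      by (intro sum.neutral) simp
    then show ?thesis
      unfolding poly_f by (simp add: sum.remove[OF I i(1)])
  qed
  finally have "int p dvd (\<Prod>k\<in>I - {i}. t k - t i)"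
    using i(2) p prime_dvd_mult_iff[of "int p"] by auto
  then show False
    using I i(1) t p by (auto simp: prime_dvd_prod_iff)
qed

section \<open>Characters of residue boxes\<close>

definition add_char :: "nat \<Rightarrow> int \<Rightarrow> complex" where
  "add_char p n = cis (2 * pi * real_of_int n / real p)"

lemma add_char_0 [simp]: "add_char p 0 = 1"
  by (simp add: add_char_def)

lemma add_char_add: "add_char p (m + n) = add_char p m * add_char p n"
  by (simp add: add_char_def cis_mult algebra_simps add_divide_distrib)

lemma add_char_minus: "add_char p (- n) = cnj (add_char p n)"
  by (simp add: add_char_def cis_cnj)

lemma norm_add_char [simp]: "norm (add_char p n) = 1"
  by (simp add: add_char_def)

lemma add_char_sum: "add_char p (sum f A) = (\<Prod>i\<in>A. add_char p (f i))"
  by (induction A rule: infinite_finite_induct) (simp_all add: add_char_add)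

lemma add_char_mult_of_nat: "add_char p (int n * k) = add_char p k ^ n"
  by (induction n) (simp_all add: add_char_add algebra_simps)

lemma add_char_eq_1_iff:
  assumes "p > 0"
  shows "add_char p n = 1 \<longleftrightarrow> int p dvd n"
proof
  assume "int p dvd n"
  then obtain k where "n = int p * k" by (auto simp: dvd_def)
  then have "2 * pi * real_of_int n / real p = 2 * pi * real_of_int k"
    using assms by simp
  then show "add_char p n = 1"
    by (simp add: add_char_def)
next
  assume "add_char p n = 1"
  then have "cos (2 * pi * real_of_int n / real p) = 1"
    by (simp add: add_char_def complex_eq_iff)
  then obtain k :: int where "2 * pi * real_of_int n / real p = real_of_int k * 2 * pi"
    using cos_one_2pi_int by auto
  then have "real_of_int n = real_of_int (k * int p)"
    using assms by (simp add: field_simps)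
  then show "int p dvd n"
    using of_int_eq_iff by (metis dvd_triv_right)
qed

lemma add_char_cong:
  assumes "p > 0" "int p dvd m - n"
  shows "add_char p m = add_char p n"
  using add_char_add[of p "m - n" n] add_char_eq_1_iff[OF assms(1), of "m - n"] assms(2) by simp

lemma sum_add_char:
  assumes "p > 0"
  shows "(\<Sum>x\<in>{0..<int p}. add_char p (x * k)) = (if int p dvd k then of_nat p else 0)"
proof -
  have "{0..<int p} = int ` {..<p}"
    by (simp add: image_int_atLeastLessThan lessThan_atLeast0)
  then have s: "(\<Sum>x\<in>{0..<int p}. add_char p (x * k)) = (\<Sum>n<p. add_char p k ^ n)"
    by (simp add: sum.reindex add_char_mult_of_nat)
  show ?thesis
  proof (cases "int p dvd k")
    case True
    then show ?thesis
      using s by (simp add: add_char_eq_1_iff[OF assms, THEN iffD2])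
  next
    case False
    then have "add_char p k \<noteq> 1"
      using add_char_eq_1_iff[OF assms] by simp
    moreover have "add_char p k ^ p = 1"
      using add_char_mult_of_nat[of p p k] add_char_eq_1_iff[OF assms, of "int p * k"] by simp
    ultimately show ?thesis
      using s False by (simp add: geometric_sum)
  qed
qed

section \<open>Residue vectors, orthogonality and Parseval\<close>

text \<open>Extensional functions give each class of integer vectors modulo \<open>p\<close> exactly
  one representative. The same sets serve as points, as frequencies and, with \<open>W\<close> in
  place of \<open>p\<close>, as cubes of side \<open>W\<close>.\<close>

definition residue_box :: "'a set \<Rightarrow> nat \<Rightarrow> ('a \<Rightarrow> int) set" where
  "residue_box I p = I \<rightarrow>\<^sub>E {0..<int p}"

lemma finite_residue_box: "finite I \<Longrightarrow> finite (residue_box I p)"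
  by (simp add: residue_box_def finite_PiE)

lemma card_residue_box: "finite I \<Longrightarrow> card (residue_box I p) = p ^ card I"
  by (simp add: residue_box_def card_PiE)

lemma residue_box_eqI:
  assumes "y \<in> residue_box I p" "z \<in> residue_box I p" "\<forall>j\<in>I. int p dvd y j - z j"
  shows "y = z"
proof (rule PiE_ext)
  show "y \<in> I \<rightarrow>\<^sub>E {0..<int p}" "z \<in> I \<rightarrow>\<^sub>E {0..<int p}"
    using assms by (simp_all add: residue_box_def)
  then show "y j = z j" if "j \<in> I" for j
    using assms(3) that by (meson atLeastLessThan_iff cong_iff_dvd_diff cong_less_imp_eq_int PiE_mem)
qed

definition vec_char :: "'a set \<Rightarrow> nat \<Rightarrow> ('a \<Rightarrow> int) \<Rightarrow> ('a \<Rightarrow> int) \<Rightarrow> complex" where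
  "vec_char I p c y = add_char p (\<Sum>j\<in>I. c j * y j)"

lemma vec_char_diff:
  "vec_char I p c (\<lambda>j. x j - y j) = vec_char I p c x * cnj (vec_char I p c y)"
  by (simp add: vec_char_def flip: add_char_minus add_char_add)
     (simp add: algebra_simps sum_subtractf)

text \<open>The sum over frequencies factors over the coordinates; divided by
  \<open>p ^ card I\<close> it is the indicator of \<open>d = 0\<close> modulo \<open>p\<close>,
  which turns congruence counts into exponential sums.\<close>

lemma sum_vec_char:
  assumes "finite I" "p > 0"
  shows "(\<Sum>c\<in>residue_box I p. vec_char I p c d)
    = (if \<forall>j\<in>I. int p dvd d j then of_nat (p ^ card I) else 0)"
proof -
  have "(\<Sum>c\<in>residue_box I p. vec_char I p c d) = (\<Prod>j\<in>I. \<Sum>x\<in>{0..<int p}. add_char p (x * d j))"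
    unfolding residue_box_def vec_char_def add_char_sum
    by (rule prod_sum_PiE[symmetric]) (use assms in auto)
  also have "\<dots> = (\<Prod>j\<in>I. if int p dvd d j then of_nat p else 0)"
    using assms by (simp add: sum_add_char)
  also have "\<dots> = (if \<forall>j\<in>I. int p dvd d j then of_nat (p ^ card I) else 0)"
    using assms by (auto intro!: prod_zero)
  finally show ?thesis .
qed

text \<open>Parseval: opening the square and summing over \<open>c\<close> first leaves only the
  pairs congruent in every coordinate, and inside a residue box these are the diagonal
  pairs.\<close>

lemma sum_norm_square_vec_char:
  assumes I: "finite I" and p: "p > 0" and Z: "Z \<subseteq> residue_box I p"
  shows "(\<Sum>c\<in>residue_box I p. (norm (\<Sum>z\<in>Z. vec_char I p c z))\<^sup>2) = real (p ^ card I) * real (card Z)"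
proof -
  have fZ: "finite Z"
    using Z finite_residue_box[OF I] finite_subset by blast
  have eq: "(\<forall>j\<in>I. int p dvd z j - z' j) \<longleftrightarrow> z = z'" if "z \<in> Z" "z' \<in> Z" for z z'
    using that Z residue_box_eqI by fastforce
  have "complex_of_real (\<Sum>c\<in>residue_box I p. (norm (\<Sum>z\<in>Z. vec_char I p c z))\<^sup>2)
      = (\<Sum>c\<in>residue_box I p. \<Sum>z\<in>Z. \<Sum>z'\<in>Z. vec_char I p c (\<lambda>j. z j - z' j))"
    by (simp add: complex_norm_square sum_product vec_char_diff flip: of_real_power)
  also have "\<dots> = (\<Sum>z\<in>Z. \<Sum>z'\<in>Z. \<Sum>c\<in>residue_box I p. vec_char I p c (\<lambda>j. z j - z' j))"
    by (subst sum.swap[where A = "residue_box I p"], rule sum.cong[OF refl], rule sum.swap)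
  also have "\<dots> = (\<Sum>z\<in>Z. \<Sum>z'\<in>Z. if z = z' then of_nat (p ^ card I) else 0)"
    by (intro sum.cong refl) (simp add: sum_vec_char[OF I p] eq)
  also have "\<dots> = complex_of_real (real (p ^ card I) * real (card Z))"
    using fZ by simp
  finally show ?thesis
    using of_real_eq_iff by blast
qed

lemma card_le_residue_box:
  assumes "finite I" "Z \<subseteq> residue_box I p"
  shows "card Z \<le> p ^ card I"
  by (metis assms card_mono card_residue_box finite_residue_box)

section \<open>Counting visits to a sumset by exponential sums\<close>

lemma sum_triple_product:
  fixes f :: "'a \<Rightarrow> 'd :: comm_semiring_0"
  shows "(\<Sum>x\<in>P \<times> Z \<times> B. f (fst x) * g (fst (snd x)) * h (snd (snd x)))
    = sum f P * sum g Z * sum h B"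
proof -
  have "sum g Z * sum h B = (\<Sum>x\<in>Z \<times> B. g (fst x) * h (snd x))"
    by (simp add: sum_product sum.cartesian_product split_def)
  then show ?thesis
    unfolding mult.assoc by (simp add: sum_product sum.cartesian_product split_def)
qed

text \<open>Triples with \<open>y w = z + u\<close> modulo \<open>p\<close> are counted by
  orthogonality. The zero frequency gives the main term; elsewhere the sum over \<open>P\<close> is
  at most \<open>K\<close> and Parseval controls the transforms of \<open>Z\<close> and
  \<open>B\<close>. Each \<open>w\<close> is met at most once for each \<open>u\<close>, hence the
  factor \<open>card B\<close> on the right.\<close>

lemma count_sumset_visits_ge:
  fixes y :: "'b \<Rightarrow> 'a \<Rightarrow> int"
  assumes I: "finite I" and p: "p > 0" and P: "finite P"
    and Z: "Z \<subseteq> residue_box I p" and B: "B \<subseteq> residue_box I p"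
    and K: "\<And>c. c \<in> residue_box I p \<Longrightarrow> \<exists>j\<in>I. c j \<noteq> 0
      \<Longrightarrow> norm (\<Sum>w\<in>P. vec_char I p c (y w)) \<le> K" and K0: "K \<ge> 0"
    and Q: "\<And>w z u. w \<in> P \<Longrightarrow> z \<in> Z \<Longrightarrow> u \<in> B
      \<Longrightarrow> \<forall>j\<in>I. int p dvd y w j - z j - u j \<Longrightarrow> Q w"
  shows "real (card P) * real (card Z) * real (card B) / real p ^ card I - K * real p ^ card I
    \<le> real (card B) * real (card {w \<in> P. Q w})"
proof -
  define G where "G = residue_box I p"
  define n where "n = p ^ card I"
  define S where "S = (\<lambda>c. \<Sum>w\<in>P. vec_char I p c (y w))"
  define Zh where "Zh = (\<lambda>c. \<Sum>z\<in>Z. vec_char I p c z)"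
  define Bh where "Bh = (\<lambda>c. \<Sum>u\<in>B. vec_char I p c u)"
  define R where "R = (\<lambda>x. \<forall>j\<in>I. int p dvd y (fst x) j - fst (snd x) j - snd (snd x) j)"
  define T where "T = {x \<in> P \<times> Z \<times> B. R x}"
  have fG: "finite G"
    unfolding G_def by (rule finite_residue_box[OF I])
  have fZ: "finite Z" and fB: "finite B"
    using Z B fG finite_subset unfolding G_def by blast+
  have n0: "real n > 0"
    using p by (simp add: n_def)
  have "of_nat n * of_nat (card T)
      = (\<Sum>x\<in>P \<times> Z \<times> B. if R x then complex_of_nat n else 0)"
    using P fZ fB by (simp add: T_def mult.commute flip: sum.inter_filter)
  also have "\<dots> = (\<Sum>x\<in>P \<times> Z \<times> B. \<Sum>c\<in>G.
      vec_char I p c (\<lambda>j. y (fst x) j - fst (snd x) j - snd (snd x) j))"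
    unfolding G_def n_def R_def by (simp add: sum_vec_char[OF I p])
  also have "\<dots> = (\<Sum>x\<in>P \<times> Z \<times> B. \<Sum>c\<in>G. vec_char I p c (y (fst x))
      * cnj (vec_char I p c (fst (snd x))) * cnj (vec_char I p c (snd (snd x))))"
    by (simp only: vec_char_diff)
  also have "\<dots> = (\<Sum>c\<in>G. \<Sum>x\<in>P \<times> Z \<times> B. vec_char I p c (y (fst x))
      * cnj (vec_char I p c (fst (snd x))) * cnj (vec_char I p c (snd (snd x))))"
    by (rule sum.swap)
  also have "\<dots> = (\<Sum>c\<in>G. S c * cnj (Zh c) * cnj (Bh c))"
    unfolding S_def Zh_def Bh_def cnj_sum
    by (intro sum.cong refl
      sum_triple_product[where f = "\<lambda>w. vec_char I p c (y w)" and g = "\<lambda>z. cnj (vec_char I p c z)"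
        and h = "\<lambda>u. cnj (vec_char I p c u)" for c])
  finally have eq: "of_nat n * of_nat (card T) = (\<Sum>c\<in>G. S c * cnj (Zh c) * cnj (Bh c))" .
  \<comment> \<open>The zero frequency as an extensional function; all characters equal 1
    there.\<close>
  define c0 :: "'a \<Rightarrow> int" where "c0 = (\<lambda>j\<in>I. 0)"
  have c0: "c0 \<in> G"
    using p by (auto simp: G_def c0_def residue_box_def)
  have "vec_char I p c0 x = 1" for x
    by (simp add: vec_char_def c0_def)
  then have F0: "S c0 * cnj (Zh c0) * cnj (Bh c0) = of_real (real (card P) * real (card Z) * real (card B))"
    by (simp add: S_def Zh_def Bh_def)
  have "norm (of_real (real n * real (card T) - real (card P) * real (card Z) * real (card B)) :: complex)
      = norm (\<Sum>c\<in>G - {c0}. S c * cnj (Zh c) * cnj (Bh c))"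
    using eq by (simp add: sum.remove[OF fG c0] F0)
  also have "\<dots> \<le> (\<Sum>c\<in>G - {c0}. K * ((norm (Zh c))\<^sup>2 + (norm (Bh c))\<^sup>2) / 2)"
  proof (rule sum_norm_le)
    fix c assume c: "c \<in> G - {c0}"
    have "\<exists>j\<in>I. c j \<noteq> 0"
    proof (rule ccontr)
      assume "\<not> ?thesis"
      then have "c = c0"
        using c c0 by (intro PiE_ext[of c I "\<lambda>_. {0..<int p}"]) (auto simp: G_def residue_box_def c0_def)
      then show False
        using c by simp
    qed
    then have "norm (S c) \<le> K"
      using c K by (simp add: S_def G_def)
    \<comment> \<open>The arithmetic-geometric mean inequality separates the two transforms, so that
      Parseval applies to each alone.\<close>
    moreover have "norm (Zh c) * norm (Bh c) \<le> ((norm (Zh c))\<^sup>2 + (norm (Bh c))\<^sup>2) / 2"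
      using sum_squares_bound[of "norm (Zh c)" "norm (Bh c)"] by simp
    ultimately have "norm (S c) * (norm (Zh c) * norm (Bh c))
        \<le> K * (((norm (Zh c))\<^sup>2 + (norm (Bh c))\<^sup>2) / 2)"
      using K0 by (intro mult_mono) auto
    then show "norm (S c * cnj (Zh c) * cnj (Bh c)) \<le> K * ((norm (Zh c))\<^sup>2 + (norm (Bh c))\<^sup>2) / 2"
      by (simp add: norm_mult mult.assoc)
  qed
  also have "\<dots> \<le> (\<Sum>c\<in>G. K * ((norm (Zh c))\<^sup>2 + (norm (Bh c))\<^sup>2) / 2)"
    using fG K0 by (intro sum_mono2) auto
  also have "\<dots> = K / 2 * ((\<Sum>c\<in>G. (norm (Zh c))\<^sup>2) + (\<Sum>c\<in>G. (norm (Bh c))\<^sup>2))"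
    by (simp add: sum_distrib_left flip: sum.distrib)
  also have "\<dots> = K / 2 * (real n * real (card Z) + real n * real (card B))"
    unfolding Zh_def Bh_def G_def n_def using Z B by (simp only: sum_norm_square_vec_char[OF I p])
  also have "\<dots> \<le> K / 2 * (real n * real n + real n * real n)"
    using card_le_residue_box[OF I Z] card_le_residue_box[OF I B] K0
    by (intro mult_left_mono add_mono) (auto simp: n_def simp flip: of_nat_power)
  also have "\<dots> = K * real n * real n"
    by simp
  finally have "\<bar>real n * real (card T) - real (card P) * real (card Z) * real (card B)\<bar> \<le> K * real n * real n"
    by (simp only: norm_of_real)
  then have "real (card P) * real (card Z) * real (card B) - K * real n * real n \<le> real n * real (card T)"
    by linarith
  then have "real (card P) * real (card Z) * real (card B) / real n - K * real n \<le> real (card T)"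
    using n0 by (simp add: field_simps)
  \<comment> \<open>For fixed \<open>w\<close> and \<open>u\<close> the congruence determines
    \<open>z\<close> modulo \<open>p\<close>, hence inside the box, so forgetting \<open>z\<close>
    is injective.\<close>
  also have "card T \<le> card (B \<times> {w \<in> P. Q w})"
  proof (rule card_inj_on_le)
    show "inj_on (\<lambda>(w, z, u). (u, w)) T"
    proof (rule inj_onI, clarsimp simp: T_def R_def)
      fix w z u z'
      assume "z \<in> Z" "z' \<in> Z" and d: "\<forall>j\<in>I. int p dvd y w j - z j - u j"
        "\<forall>j\<in>I. int p dvd y w j - z' j - u j"
      have "\<forall>j\<in>I. int p dvd z j - z' j"
      proof
        fix j assume "j \<in> I"
        then have "int p dvd (y w j - z' j - u j) - (y w j - z j - u j)"
          using d by (meson dvd_diff)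
        then show "int p dvd z j - z' j"
          by (simp add: algebra_simps)
      qed
      then show "z = z'"
        using \<open>z \<in> Z\<close> \<open>z' \<in> Z\<close> Z residue_box_eqI by blast
    qed
    show "(\<lambda>(w, z, u). (u, w)) ` T \<subseteq> B \<times> {w \<in> P. Q w}"
      using Q by (auto simp: T_def R_def)
    show "finite (B \<times> {w \<in> P. Q w})"
      using fB P by simp
  qed
  finally show ?thesis
    by (simp add: n_def card_cartesian_product)
qed

section \<open>Exponential sums over the Fermat quotient matrix\<close>

text \<open>For fixed \<open>b\<close> the phase is \<open>\<alpha> b - a * \<beta> b\<close>, so
  the complete sum over \<open>a\<close> is 0 unless \<open>p\<close> divides
  \<open>\<beta> b\<close>. The exceptional \<open>b\<close> are zeros of a sum of reciprocals,
  hence at most \<open>card I\<close> in number, and each contributes norm \<open>p\<close>.\<close>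

lemma norm_sum_vec_char_fermat_matrix_le:
  fixes s t :: "'a \<Rightarrow> int"
  assumes p: "prime p" and I: "finite I"
    and t: "\<And>j k. j \<in> I \<Longrightarrow> k \<in> I \<Longrightarrow> j \<noteq> k \<Longrightarrow> \<not> int p dvd t j - t k"
    and J: "J \<subseteq> {0..<int p}"
    and J_t: "\<And>b j. b \<in> J \<Longrightarrow> j \<in> I \<Longrightarrow> \<not> int p dvd b + t j"
    and c: "c \<in> residue_box I p" "\<exists>j\<in>I. c j \<noteq> 0"
  shows "norm (\<Sum>(a, b)\<in>{0..<int p} \<times> J. vec_char I p c (\<lambda>j. fermat_matrix p (a + s j) (b + t j)))
    \<le> real (card I * p)"
proof -
  have p0: "p > 0"
    using p prime_gt_0_nat by blast
  \<comment> \<open>The argument of the Fermat quotient with the contribution \<open>a * p\<close>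
    removed.\<close>
  define m where "m = (\<lambda>b j. s j * int p + (b + t j))"
  define \<alpha> where "\<alpha> = (\<lambda>b. \<Sum>j\<in>I. c j * fermat_quotient p (m b j))"
  define \<beta> where "\<beta> = (\<lambda>b. \<Sum>j\<in>I. c j * (b + t j) ^ (p - 2))"
  have fJ: "finite J"
    using J finite_subset by blast
  have inner: "(\<Sum>a\<in>{0..<int p}. vec_char I p c (\<lambda>j. fermat_matrix p (a + s j) (b + t j)))
      = add_char p (\<alpha> b) * (if int p dvd \<beta> b then of_nat p else 0)" if b: "b \<in> J" for b
  proof -
    have "vec_char I p c (\<lambda>j. fermat_matrix p (a + s j) (b + t j))
        = add_char p (\<alpha> b) * add_char p (a * (- \<beta> b))" for a
    proof -
      have "[(\<Sum>j\<in>I. c j * fermat_matrix p (a + s j) (b + t j))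
          = (\<Sum>j\<in>I. c j * (fermat_quotient p (m b j) - a * (b + t j) ^ (p - 2)))] (mod int p)"
      proof (rule cong_sum)
        fix j assume j: "j \<in> I"
        have m: "[m b j = b + t j] (mod int p)"
          by (simp add: m_def cong_iff_dvd_diff)
        then have "\<not> int p dvd m b j"
          using J_t[OF b j] cong_dvd_iff by blast
        then have "[fermat_quotient p (m b j + a * int p)
            = fermat_quotient p (m b j) - a * m b j ^ (p - 2)] (mod int p)"
          using fermat_quotient_shift[OF p] by (simp add: cong_iff_dvd_diff)
        moreover have "fermat_matrix p (a + s j) (b + t j) = fermat_quotient p (m b j + a * int p)"
          by (simp add: fermat_matrix_def m_def algebra_simps)
        \<comment> \<open>The multiple \<open>s j * p\<close> inside \<open>m b j\<close> vanishes
          modulo \<open>p\<close>, so the slope depends on \<open>b + t j\<close> alone.\<close>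
        moreover have "[fermat_quotient p (m b j) - a * m b j ^ (p - 2)
            = fermat_quotient p (m b j) - a * (b + t j) ^ (p - 2)] (mod int p)"
          by (intro cong_diff cong_refl cong_scalar_left cong_pow m)
        ultimately show "[c j * fermat_matrix p (a + s j) (b + t j)
            = c j * (fermat_quotient p (m b j) - a * (b + t j) ^ (p - 2))] (mod int p)"
          by (metis cong_scalar_left cong_trans)
      qed
      also have "(\<Sum>j\<in>I. c j * (fermat_quotient p (m b j) - a * (b + t j) ^ (p - 2)))
          = \<alpha> b + a * (- \<beta> b)"
        by (simp add: \<alpha>_def \<beta>_def sum_distrib_left algebra_simps sum_subtractf)
      finally show ?thesis
        using p0 by (simp add: vec_char_def cong_iff_dvd_diff add_char_cong flip: add_char_add)
    qed
    then show ?thesis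
      using sum_add_char[OF p0, of "- \<beta> b"] by (simp flip: sum_distrib_left)
  qed
  have "(\<Sum>(a, b)\<in>{0..<int p} \<times> J. vec_char I p c (\<lambda>j. fermat_matrix p (a + s j) (b + t j)))
      = (\<Sum>b\<in>J. \<Sum>a\<in>{0..<int p}. vec_char I p c (\<lambda>j. fermat_matrix p (a + s j) (b + t j)))"
    by (subst sum.swap) (simp add: sum.cartesian_product)
  also have "norm \<dots> \<le> (\<Sum>b\<in>J. if int p dvd \<beta> b then real p else 0)"
    by (rule sum_norm_le) (simp add: inner norm_mult)
  also have "\<dots> = real (card {b \<in> J. int p dvd \<beta> b} * p)"
    using fJ by (simp flip: sum.inter_filter)
  also have "card {b \<in> J. int p dvd \<beta> b} \<le> card I"
  proof -
    obtain i where i: "i \<in> I" "c i \<noteq> 0"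
      using c by blast
    then have "c i > 0" "c i < int p"
      using c(1) by (fastforce simp: residue_box_def PiE_iff)+
    then have "\<not> int p dvd c i"
      using zdvd_not_zless by blast
    then show ?thesis
      using J J_t by (intro card_vanishing_power_combination_le[OF p I i(1) _ t])
        (auto simp: \<beta>_def)
  qed
  finally show ?thesis
    by (simp add: mult_right_mono)
qed

section \<open>Chains with gaps\<close>

text \<open>The right side is the falling product of the \<open>k\<close> factors from
  \<open>n\<close> down to \<open>n - k + 1\<close>, each at least \<open>n - k\<close>; for
  \<open>k > n\<close> truncated subtraction makes the left side 0.\<close>

lemma falling_power_le_binomial: "(n - k) ^ k \<le> fact k * (n choose k)"
proof (induction k)
  case (Suc k)
  have "(n - Suc k) ^ Suc k \<le> (n - k) * (n - k) ^ k"
    by (simp add: mult_mono power_mono)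
  also have "\<dots> \<le> (n - k) * (fact k * (n choose k))"
    using Suc by simp
  also have "\<dots> = fact k * (Suc k * (n choose Suc k))"
    using binomial_absorb_comp[of n k] binomial_absorption[of k n] by simp
  also have "\<dots> = fact (Suc k) * (n choose Suc k)"
    by (simp add: algebra_simps)
  finally show ?case .
qed simp

text \<open>Adding a vector of the cube \<open>[0, W)^N\<close> preserves the order because of the
  gaps, and the last condition keeps the sum below \<open>p\<close>, so that nothing wraps around
  modulo \<open>p\<close>.\<close>

definition gap_chains :: "(nat \<Rightarrow> nat) \<Rightarrow> nat \<Rightarrow> nat \<Rightarrow> nat \<Rightarrow> (nat \<Rightarrow> int) set" where
  "gap_chains \<sigma> N p W = {z \<in> residue_box {1..N} p.
     (\<forall>i\<in>{1..<N}. z (\<sigma> i) + int W \<le> z (\<sigma> (i + 1))) \<and> (\<forall>j\<in>{1..N}. z j + int W \<le> int p)}"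

text \<open>The usual substitution: adding \<open>(i - 1) W\<close> to the \<open>i\<close>-th smallest element of an
  \<open>N\<close>-subset of \<open>{..<p - N W}\<close> creates the gaps.\<close>

lemma binomial_le_card_gap_chains:
  assumes \<sigma>: "\<sigma> permutes {1..N}" and W: "W > 0" and le: "N * W \<le> p"
  shows "(p - N * W) choose N \<le> card (gap_chains \<sigma> N p W)"
proof -
  define m where "m = p - N * W"
  define subs where "subs = {S. S \<subseteq> {..<m} \<and> card S = N}"
  \<comment> \<open>The inverse of \<open>\<sigma>\<close> gives the rank of \<open>j\<close>; ranks
    start at 1 and list positions at 0, hence the \<open>- 1\<close>.\<close>
  define f where "f = (\<lambda>S. \<lambda>j\<in>{1..N}.
    int (sorted_list_of_set S ! (inv_into UNIV \<sigma> j - 1)) + int ((inv_into UNIV \<sigma> j - 1) * W))"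
  have inv: "inv_into UNIV \<sigma> (\<sigma> i) = i" for i
    by (rule permutes_inverses(2)[OF \<sigma>])
  have \<sigma>_in: "\<sigma> i \<in> {1..N} \<longleftrightarrow> i \<in> {1..N}" for i
    using permutes_in_image[OF \<sigma>] .
  have f: "f S (\<sigma> i) = int (sorted_list_of_set S ! (i - 1)) + int ((i - 1) * W)" if "i \<in> {1..N}" for S i
    using that \<sigma>_in[of i] by (simp add: f_def inv)
  have len: "length (sorted_list_of_set S) = N" if "S \<in> subs" for S
    using that by (simp add: subs_def)
  have set: "set (sorted_list_of_set S) = S" if "S \<in> subs" for S
    using that by (auto simp: subs_def finite_subset[of S "{..<m}"])
  \<comment> \<open>An element below \<open>p - N W\<close>, shifted by at most
    \<open>(N - 1) W\<close>, still leaves room \<open>W\<close> below \<open>p\<close>.\<close>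
  have top: "0 \<le> f S j \<and> f S j + int W \<le> int p" if S: "S \<in> subs" and j: "j \<in> {1..N}" for S j
  proof -
    obtain i where i: "j = \<sigma> i" "i \<in> {1..N}"
      using j permutes_image[OF \<sigma>] by blast
    have "sorted_list_of_set S ! (i - 1) \<in> set (sorted_list_of_set S)"
      by (rule nth_mem) (use i len[OF S] in auto)
    then have "sorted_list_of_set S ! (i - 1) < m"
      using S set[OF S] by (auto simp: subs_def)
    moreover have "(i - 1) * W + W \<le> N * W"
    proof -
      have "(i - 1) * W + W = i * W"
        using i(2) by (cases i) auto
      then show ?thesis
        using i(2) by simp
    qed
    ultimately have "sorted_list_of_set S ! (i - 1) + (i - 1) * W + W \<le> p"
      using le by (simp add: m_def)
    then have "int (sorted_list_of_set S ! (i - 1) + (i - 1) * W + W) \<le> int p"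
      by (simp only: of_nat_le_iff)
    then show ?thesis
      unfolding i(1) f[OF i(2)] by simp
  qed
  have "card subs \<le> card (gap_chains \<sigma> N p W)"
  proof (rule card_inj_on_le)
    show "inj_on f subs"
    proof (rule inj_onI)
      fix S S' assume S: "S \<in> subs" "S' \<in> subs" and eq: "f S = f S'"
      have "sorted_list_of_set S = sorted_list_of_set S'"
      proof (rule nth_equalityI)
        fix i assume "i < length (sorted_list_of_set S)"
        then have "Suc i \<in> {1..N}"
          using len S by simp
        then show "sorted_list_of_set S ! i = sorted_list_of_set S' ! i"
          using fun_cong[OF eq, of "\<sigma> (Suc i)"] by (simp only: f diff_Suc_1)
      qed (use len S in simp)
      then show "S = S'"
        using set S by metis
    qed
    show "f ` subs \<subseteq> gap_chains \<sigma> N p W"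
    proof (rule image_subsetI)
      fix S assume S: "S \<in> subs"
      have "f S (\<sigma> i) + int W \<le> f S (\<sigma> (i + 1))" if i: "i \<in> {1..<N}" for i
      proof -
        have "sorted_wrt (<) (sorted_list_of_set S)"
          by simp
        then have "sorted_list_of_set S ! (i - 1) < sorted_list_of_set S ! i"
          by (rule sorted_wrt_nth_less) (use i len[OF S] in auto)
        moreover have "i * W = (i - 1) * W + W"
          using i by (cases i) auto
        ultimately show ?thesis
          using i f[of i S] f[of "i + 1" S] by simp
      qed
      moreover have "f S \<in> residue_box {1..N} p"
        using top[OF S] W by (fastforce simp: residue_box_def f_def)
      ultimately show "f S \<in> gap_chains \<sigma> N p W"
        using top[OF S] by (simp add: gap_chains_def)
    qed
    have "finite (residue_box {1..N} p)"
      by (simp add: finite_residue_box)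
    then show "finite (gap_chains \<sigma> N p W)"
      by (rule finite_subset[rotated]) (auto simp: gap_chains_def)
  qed
  then show ?thesis
    by (simp add: subs_def m_def n_subsets)
qed

text \<open>The binomial count is at least \<open>(p - N W - N)^N / N!\<close>, and Bernoulli's
  inequality makes its relative loss linear in \<open>W / p\<close>.\<close>

lemma card_gap_chains_ge:
  assumes \<sigma>: "\<sigma> permutes {1..N}" and W: "W > 0" and p: "p > 0"
  shows "(1 - real N * (real N * real W + real N) / real p) / fact N
    \<le> real (card (gap_chains \<sigma> N p W)) / real p ^ N"
proof (cases "N * W + N \<le> p")
  case True
  define x where "x = (real N * real W + real N) / real p"
  have x: "x \<le> 1"
    using True p by (simp add: x_def flip: of_nat_mult of_nat_add)
  have "1 - real N * x \<le> (1 - x) ^ N"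
    using Bernoulli_inequality[of "- x" N] x by simp
  also have "\<dots> = (real (p - N * W - N) / real p) ^ N"
    using True p by (simp add: x_def of_nat_diff field_simps)
  also have "\<dots> = real ((p - N * W - N) ^ N) / real p ^ N"
    by (simp add: power_divide)
  also have "(p - N * W - N) ^ N \<le> fact N * card (gap_chains \<sigma> N p W)"
  proof -
    have "(p - N * W - N) ^ N \<le> fact N * ((p - N * W) choose N)"
      by (rule falling_power_le_binomial)
    also have "\<dots> \<le> fact N * card (gap_chains \<sigma> N p W)"
      using binomial_le_card_gap_chains[OF \<sigma> W] True by simp
    finally show ?thesis .
  qed
  finally have "1 - real N * x \<le> fact N * (real (card (gap_chains \<sigma> N p W)) / real p ^ N)"
    by (simp add: divide_right_mono of_nat_fact)
  then show ?thesis
    by (simp add: x_def field_simps)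
next
  \<comment> \<open>Here \<open>p < N W + N\<close>, so the left side is nonpositive.\<close>
  case False
  then have N: "N \<ge> 1"
    using p by (cases N) auto
  have "real p \<le> 1 * (real N * real W + real N)"
    using False by (simp flip: of_nat_mult of_nat_add)
  also have "\<dots> \<le> real N * (real N * real W + real N)"
    using N by (intro mult_right_mono) auto
  finally have "(1 - real N * (real N * real W + real N) / real p) / fact N \<le> 0"
    using p by (simp add: field_simps)
  also have "0 \<le> real (card (gap_chains \<sigma> N p W)) / real p ^ N"
    by simp
  finally show ?thesis .
qed

section \<open>Counting ordered positions\<close>

definition ordered_positions where
  "ordered_positions N v p \<sigma> =
     {(a, b) \<in> admissible_positions N v p. pattern_point N v p a b \<in> order_simplex \<sigma> N}"

lemma admissible_positions_subset:
  assumes "N \<ge> 1"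
  shows "admissible_positions N v p \<subseteq> {0..<int p} \<times> {0..<int p}"
  using assms by (auto simp: admissible_positions_def dest!: bspec[of _ _ 1])

lemma fermat_matrix_range: "p > 0 \<Longrightarrow> fermat_matrix p a b \<in> {0..<int p}"
  by (simp add: fermat_matrix_def fermat_quotient_def)

text \<open>The common factor \<open>1 / p\<close> cancels and membership in the unit cube is
  automatic, leaving inequalities between integers.\<close>

lemma pattern_point_in_order_simplex_iff:
  assumes p: "p > 0" and \<sigma>: "\<sigma> permutes {1..N}"
  shows "pattern_point N v p a b \<in> order_simplex \<sigma> N \<longleftrightarrow>
    (\<forall>i\<in>{1..<N}. fermat_matrix p (a + fst (v (\<sigma> i))) (b + snd (v (\<sigma> i)))
      < fermat_matrix p (a + fst (v (\<sigma> (i + 1)))) (b + snd (v (\<sigma> (i + 1)))))"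
proof -
  have "real_of_int (fermat_matrix p a b) / real p \<in> {0..1}" for a b
    using p fermat_matrix_range[OF p, of a b] by simp
  then have "pattern_point N v p a b \<in> {1..N} \<rightarrow>\<^sub>E {0..1}"
    unfolding pattern_point_def by (intro restrict_PiE_iff[THEN iffD2]) blast
  moreover have "\<sigma> i \<in> {1..N} \<and> \<sigma> (i + 1) \<in> {1..N}" if "i \<in> {1..<N}" for i
    using permutes_in_image[OF \<sigma>, of i] permutes_in_image[OF \<sigma>, of "i + 1"] that by auto
  ultimately show ?thesis
    using p by (auto simp: order_simplex_def pattern_point_def divide_less_cancel)
qed

text \<open>The sumset count is run on all \<open>p\<close> values of \<open>a\<close>, a complete
  period, with \<open>b\<close> restricted to \<open>J\<close>; inadmissible \<open>a\<close> are
  discarded afterwards. The errors come from trimming (\<open>2 M + 1\<close> values of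
  \<open>b\<close>, \<open>2 M\<close> of \<open>a\<close>), from the volume lost to gaps, and from
  the nonzero frequencies.\<close>

lemma card_ordered_positions_ge_with_gap:
  fixes M :: int
  assumes v: "\<And>j. j \<in> {1..N} \<Longrightarrow> \<bar>fst (v j)\<bar> \<le> M \<and> \<bar>snd (v j)\<bar> \<le> M"
    and inj: "inj_on (\<lambda>j. snd (v j)) {1..N}" and M: "M \<ge> 0"
    and p: "prime p" "2 * M + 1 \<le> int p" and \<sigma>: "\<sigma> permutes {1..N}"
    and W: "W > 0" "W \<le> p" and N: "N \<ge> 1"
  shows "real p ^ 2 / fact N - ((4 * real_of_int M + 1) * real p
      + real N ^ 2 * (real W + 1) * real p + real N * real p * (real p / real W) ^ N)
    \<le> real (card (ordered_positions N v p \<sigma>))"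
proof -
  have p0: "p > 0"
    using p prime_gt_0_nat by blast
  \<comment> \<open>For these \<open>b\<close> every \<open>b + t j\<close> lies between 1 and
    \<open>p - 1\<close>, hence is prime to \<open>p\<close>.\<close>
  define J where "J = {M + 1..int p - 1 - M}"
  define P where "P = {0..<int p} \<times> J"
  define y where "y = (\<lambda>(a, b) j. fermat_matrix p (a + fst (v j)) (b + snd (v j)))"
  define Q where "Q = (\<lambda>(a, b). pattern_point N v p a b \<in> order_simplex \<sigma> N)"
  define B where "B = residue_box {1..N} W"
  define Z where "Z = gap_chains \<sigma> N p W"
  have Z_box: "Z \<subseteq> residue_box {1..N} p"
    by (auto simp: Z_def gap_chains_def)
  have B_box: "B \<subseteq> residue_box {1..N} p"
    unfolding B_def residue_box_def using W by (intro PiE_mono) auto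
  have card_B: "card B = W ^ N"
    by (simp add: B_def card_residue_box)
  have card_P: "real (card P) = real p * (real p - 1 - 2 * real_of_int M)"
    using p(2) by (simp add: P_def J_def card_cartesian_product of_nat_nat)
  have "real (card P) * real (card Z) * real (card B) / real p ^ card {1..N}
      - real (card {1..N} * p) * real p ^ card {1..N} \<le> real (card B) * real (card {w \<in> P. Q w})"
  proof (rule count_sumset_visits_ge[OF _ p0 _ Z_box B_box])
    show "finite P"
      by (simp add: P_def J_def)
    fix c assume c: "c \<in> residue_box {1..N} p" "\<exists>j\<in>{1..N}. c j \<noteq> 0"
    have "norm (\<Sum>(a, b)\<in>{0..<int p} \<times> J.
        vec_char {1..N} p c (\<lambda>j. fermat_matrix p (a + fst (v j)) (b + snd (v j))))
      \<le> real (card {1..N} * p)"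
    proof (rule norm_sum_vec_char_fermat_matrix_le[OF p(1) _ _ _ _ c])
      show "\<not> int p dvd snd (v j) - snd (v k)" if "j \<in> {1..N}" "k \<in> {1..N}" "j \<noteq> k" for j k
      proof
        assume "int p dvd snd (v j) - snd (v k)"
        moreover have "snd (v j) - snd (v k) \<noteq> 0"
          using inj that by (auto dest: inj_onD)
        \<comment> \<open>The difference is at most \<open>2 M\<close> in absolute value, less than
          \<open>p\<close>, so distinct \<open>t j\<close> stay distinct modulo
          \<open>p\<close>.\<close>
        ultimately have "int p \<le> \<bar>snd (v j) - snd (v k)\<bar>"
          using dvd_imp_le_int[of "snd (v j) - snd (v k)" "int p"] by simp
        then show False
          using v[OF that(1)] v[OF that(2)] p(2) by linarith
      qed
      show "J \<subseteq> {0..<int p}"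
        using M by (auto simp: J_def)
      show "\<not> int p dvd b + snd (v j)" if "b \<in> J" "j \<in> {1..N}" for b j
        using that v[OF that(2)] by (intro zdvd_not_zless) (auto simp: J_def)
    qed simp
    then show "norm (\<Sum>w\<in>P. vec_char {1..N} p c (y w)) \<le> real (card {1..N} * p)"
      by (simp add: P_def y_def split_def)
  next
    fix w z u
    assume z: "z \<in> Z" and u: "u \<in> B" and d: "\<forall>j\<in>{1..N}. int p dvd y w j - z j - u j"
    obtain a b where w: "w = (a, b)"
      by fastforce
    have u_range: "0 \<le> u j \<and> u j < int W" if "j \<in> {1..N}" for j
      using u that PiE_mem[of u "{1..N}" "\<lambda>_. {0..<int W}" j] by (simp add: B_def residue_box_def)
    \<comment> \<open>Both sides lie in \<open>[0, p)\<close>, so the congruence is an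
      equality.\<close>
    have y: "y w j = z j + u j" if j: "j \<in> {1..N}" for j
    proof (rule cong_less_imp_eq_int[of _ "int p"])
      have "y w j \<in> {0..<int p}"
        using fermat_matrix_range[OF p0] by (simp add: w y_def)
      then show "0 \<le> y w j" "y w j < int p"
        by auto
      have "z j \<in> {0..<int p}"
        using subsetD[OF Z_box z] j unfolding residue_box_def by (rule PiE_mem)
      moreover have "z j + int W \<le> int p"
        using z j unfolding Z_def gap_chains_def by blast
      ultimately have "0 \<le> z j" "z j + int W \<le> int p"
        by simp_all
      then show "0 \<le> z j + u j" "z j + u j < int p"
        using u_range[OF j] by linarith+
      show "[y w j = z j + u j] (mod int p)"
        using d j by (simp add: cong_iff_dvd_diff diff_diff_eq)
    qed
    have "y w (\<sigma> i) < y w (\<sigma> (i + 1))" if i: "i \<in> {1..<N}" for i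
    proof -
      have \<sigma>i: "\<sigma> i \<in> {1..N}" "\<sigma> (i + 1) \<in> {1..N}"
        using permutes_in_image[OF \<sigma>, of i] permutes_in_image[OF \<sigma>, of "i + 1"] i by auto
      have "z (\<sigma> i) + int W \<le> z (\<sigma> (i + 1))"
        using z i unfolding Z_def gap_chains_def by blast
      then show ?thesis
        using y[OF \<sigma>i(1)] y[OF \<sigma>i(2)] u_range[OF \<sigma>i(1)] u_range[OF \<sigma>i(2)] by linarith
    qed
    then show "Q w"
      by (simp add: Q_def w pattern_point_in_order_simplex_iff[OF p0 \<sigma>] y_def)
  qed simp_all
  then have main: "real (card P) * real (card Z) * real W ^ N / real p ^ N - real N * real p * real p ^ N
      \<le> real W ^ N * real (card {w \<in> P. Q w})"
    by (simp add: card_B)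
  define \<theta> where "\<theta> = real (card Z) / real p ^ N"
  have WN: "real W ^ N > 0"
    using W by simp
  have "real W ^ N * (real (card P) * \<theta> - real N * real p * (real p / real W) ^ N)
      = real (card P) * real (card Z) * real W ^ N / real p ^ N - real N * real p * real p ^ N"
    using W by (simp add: \<theta>_def field_simps power_divide)
  with main have "real W ^ N * (real (card P) * \<theta> - real N * real p * (real p / real W) ^ N)
      \<le> real W ^ N * real (card {w \<in> P. Q w})"
    by simp
  then have visits: "real (card P) * \<theta> - real N * real p * (real p / real W) ^ N
      \<le> real (card {w \<in> P. Q w})"
    using WN mult_le_cancel_left_pos by blast
  have \<theta>1: "\<theta> \<le> 1"
    using card_le_residue_box[OF _ Z_box] p0 by (simp add: \<theta>_def divide_le_eq flip: of_nat_power)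
  \<comment> \<open>The density bound for \<open>Z\<close> carries this error divided by
    \<open>fact N\<close>; the denominator is at least 1 and is dropped.\<close>
  have "real p ^ 2 / fact N - real N ^ 2 * (real W + 1) * real p
      \<le> real p ^ 2 / fact N - real N ^ 2 * (real W + 1) * real p / fact N"
    using divide_left_mono[of 1 "fact N" "real N ^ 2 * (real W + 1) * real p"] by simp
  also have "\<dots> = real p ^ 2 * ((1 - real N * (real N * real W + real N) / real p) / fact N)"
    using p0 by (simp add: field_simps power2_eq_square)
  also have "\<dots> \<le> real p ^ 2 * \<theta>"
    unfolding \<theta>_def Z_def by (intro mult_left_mono card_gap_chains_ge[OF \<sigma> W(1) p0]) simp
  \<comment> \<open>\<open>P\<close> misses \<open>(2 M + 1) p\<close> of the \<open>p^2\<close>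
    positions.\<close>
  also have "\<dots> = real (card P) * \<theta> + (2 * real_of_int M + 1) * real p * \<theta>"
    by (simp add: card_P power2_eq_square algebra_simps)
  also have "\<dots> \<le> real (card P) * \<theta> + (2 * real_of_int M + 1) * real p"
    using mult_left_mono[OF \<theta>1, of "(2 * real_of_int M + 1) * real p"] M by simp
  finally have volume: "real p ^ 2 / fact N - real N ^ 2 * (real W + 1) * real p
    \<le> real (card P) * \<theta> + (2 * real_of_int M + 1) * real p" .
  have "card {w \<in> P. Q w} \<le> card (ordered_positions N v p \<sigma> \<union> ({0..<M} \<union> {int p - M..<int p}) \<times> J)"
  proof (rule card_mono)
    have "ordered_positions N v p \<sigma> \<subseteq> {0..<int p} \<times> {0..<int p}"
      using admissible_positions_subset[OF N] by (auto simp: ordered_positions_def)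
    then show "finite (ordered_positions N v p \<sigma> \<union> ({0..<M} \<union> {int p - M..<int p}) \<times> J)"
      by (auto simp: J_def intro: finite_subset)
    show "{w \<in> P. Q w} \<subseteq> ordered_positions N v p \<sigma> \<union> ({0..<M} \<union> {int p - M..<int p}) \<times> J"
    proof
      fix w assume w: "w \<in> {w \<in> P. Q w}"
      obtain a b where ab: "w = (a, b)"
        by fastforce
      show "w \<in> ordered_positions N v p \<sigma> \<union> ({0..<M} \<union> {int p - M..<int p}) \<times> J"
      proof (cases "M \<le> a \<and> a \<le> int p - 1 - M")
        case True
        have b: "M + 1 \<le> b" "b \<le> int p - 1 - M"
          using w by (auto simp: ab P_def J_def)
        have "0 \<le> a \<and> a \<le> int p - 1 \<and> 1 \<le> b \<and> b \<le> int p - 1 \<and>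
            0 \<le> a + fst (v j) \<and> a + fst (v j) \<le> int p - 1 \<and>
            1 \<le> b + snd (v j) \<and> b + snd (v j) \<le> int p - 1" if "j \<in> {1..N}" for j
          using True b M v[OF that] by linarith
        then have "w \<in> ordered_positions N v p \<sigma>"
          using w by (simp add: ab ordered_positions_def admissible_positions_def Q_def)
        then show ?thesis
          by simp
      next
        case False
        then show ?thesis
          using w by (auto simp: ab P_def)
      qed
    qed
  qed
  also have "\<dots> \<le> card (ordered_positions N v p \<sigma>) + card (({0..<M} \<union> {int p - M..<int p}) \<times> J)"
    by (rule card_Un_le)
  also have "card (({0..<M} \<union> {int p - M..<int p}) \<times> J) \<le> (nat M + nat M) * p"
  proof -
    have "card ({0..<M} \<union> {int p - M..<int p}) \<le> nat M + nat M"
      using card_Un_le[of "{0..<M}" "{int p - M..<int p}"] by simp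
    moreover have "card J \<le> p"
      using M by (simp add: J_def)
    ultimately show ?thesis
      by (simp only: card_cartesian_product mult_le_mono)
  qed
  finally have "real (card {w \<in> P. Q w}) \<le> real (card (ordered_positions N v p \<sigma>) + (nat M + nat M) * p)"
    by (simp only: of_nat_le_iff)
  also have "\<dots> = real (card (ordered_positions N v p \<sigma>)) + 2 * real_of_int M * real p"
    using M by (simp add: of_nat_nat)
  finally show ?thesis
    using visits volume by (simp add: algebra_simps)
qed

text \<open>Balancing \<open>p W\<close> against \<open>p (p / W)^N\<close> gives \<open>W\<close>
  close to \<open>R = p^(N/(N+1))\<close>, for which \<open>(p / R)^N = R\<close>; both errors are
  then of order \<open>p R\<close>.\<close>

lemma card_ordered_positions_ge:
  fixes M :: int
  assumes v: "\<And>j. j \<in> {1..N} \<Longrightarrow> \<bar>fst (v j)\<bar> \<le> M \<and> \<bar>snd (v j)\<bar> \<le> M"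
    and inj: "inj_on (\<lambda>j. snd (v j)) {1..N}" and M: "M \<ge> 0"
    and p: "prime p" and \<sigma>: "\<sigma> permutes {1..N}" and N: "N \<ge> 1"
  shows "real p ^ 2 / fact N - (4 * real_of_int M + 1 + 3 * real N ^ 2 + real N)
      * real p powr (real (2 * N + 1) / real (N + 1))
    \<le> real (card (ordered_positions N v p \<sigma>))"
proof -
  have p1: "real p \<ge> 1"
    using prime_ge_1_nat[OF p] by simp
  define R where "R = real p powr (real N / real (N + 1))"
  have pR: "real p powr (real (2 * N + 1) / real (N + 1)) = real p * R"
  proof -
    have "real (2 * N + 1) / real (N + 1) = 1 + real N / real (N + 1)"
      by (simp add: field_simps)
    then show ?thesis
      using p1 by (simp only: powr_add R_def) simp
  qed
  have R1: "R \<ge> 1"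
    using p1 by (simp add: R_def ge_one_powr_ge_zero)
  have Rp: "R \<le> real p"
    using p1 powr_mono[of "real N / real (N + 1)" 1 "real p"] by (simp add: R_def)
  show ?thesis
  proof (cases "2 * M + 1 \<le> int p")
    case True
    \<comment> \<open>Since \<open>R\<close> is at least 1, rounding up at most doubles it, and
      \<open>W + 1\<close> is at most \<open>3 R\<close>.\<close>
    define W where "W = nat \<lceil>R\<rceil>"
    have W: "R \<le> real W" "real W \<le> 2 * R"
      using R1 by (simp_all add: W_def) linarith+
    have "W \<le> p"
      using Rp by (simp add: W_def nat_le_iff ceiling_le_iff)
    have "(real p / real W) ^ N \<le> (real p / R) ^ N"
      using W R1 by (intro power_mono divide_left_mono) auto
    also have "real p / R = real p powr (1 / real (N + 1))"
    proof -
      have "1 / real (N + 1) = 1 - real N / real (N + 1)"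
        by (simp add: field_simps)
      then show ?thesis
        using p1 by (simp only: powr_diff R_def) simp
    qed
    also have "\<dots> ^ N = R"
      using p1 by (simp add: R_def powr_powr flip: powr_realpow)
    finally have "real N * real p * (real p / real W) ^ N \<le> real N * real p * R"
      by (intro mult_left_mono) simp_all
    moreover have "real N ^ 2 * (real W + 1) * real p \<le> real N ^ 2 * (3 * R) * real p"
      using W R1 by (intro mult_left_mono mult_right_mono) auto
    moreover have "(4 * real_of_int M + 1) * real p \<le> (4 * real_of_int M + 1) * (real p * R)"
      using M R1 p1 by (intro mult_left_mono) auto
    ultimately have "(4 * real_of_int M + 1) * real p + real N ^ 2 * (real W + 1) * real p
        + real N * real p * (real p / real W) ^ N
      \<le> (4 * real_of_int M + 1 + 3 * real N ^ 2 + real N) * (real p * R)"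
      by (simp add: algebra_simps)
    moreover have "W > 0"
      using W R1 by (intro gr0I) simp
    ultimately show ?thesis
      using card_ordered_positions_ge_with_gap[OF v inj M p True \<sigma> _ \<open>W \<le> p\<close> N] unfolding pR by linarith
  next
    case False
    then have "real p \<le> 2 * real_of_int M + 1"
      by linarith
    \<comment> \<open>For primes this small \<open>p^2\<close> is itself within the error term, so
      the claimed lower bound is nonpositive.\<close>
    have "real p ^ 2 / fact N \<le> real p ^ 2"
      by (simp add: divide_le_eq mult_le_cancel_left1 fact_ge_1)
    also have "\<dots> \<le> (2 * real_of_int M + 1) * (real p * R)"
      unfolding power2_eq_square using \<open>real p \<le> 2 * real_of_int M + 1\<close> R1 p1 M
      by (intro mult_mono) auto
    also have "\<dots> \<le> (4 * real_of_int M + 1 + 3 * real N ^ 2 + real N) * (real p * R)"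
      using M p1 R1 by (intro mult_right_mono) auto
    finally show ?thesis
      unfolding pR by linarith
  qed
qed

section \<open>From lower bounds for all permutations to two-sided bounds\<close>

lemma sorting_permutation_unique:
  fixes x :: "nat \<Rightarrow> 'a :: linorder"
  assumes \<sigma>: "\<sigma> permutes {1..N}" "\<forall>i\<in>{1..<N}. x (\<sigma> i) < x (\<sigma> (i + 1))"
    and \<tau>: "\<tau> permutes {1..N}" "\<forall>i\<in>{1..<N}. x (\<tau> i) < x (\<tau> (i + 1))"
  shows "\<sigma> = \<tau>"
proof -
  define L where "L = (\<lambda>\<rho>. map (\<lambda>i. x (\<rho> i)) [1..<Suc N])"
  have sorted: "sorted_wrt (<) (L \<rho>)" if "\<forall>i\<in>{1..<N}. x (\<rho> i) < x (\<rho> (i + 1))" for \<rho>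
    using that unfolding L_def by (subst sorted_wrt_iff_nth_Suc_transp) (auto simp del: upt_Suc)
  have set: "set (L \<rho>) = x ` {1..N}" if "\<rho> permutes {1..N}" for \<rho>
    using permutes_image[OF that] by (simp add: L_def image_image[symmetric, of x \<rho>] del: upt_Suc)
      (simp add: atLeastLessThanSuc_atLeastAtMost)
  have "L \<sigma> = L \<tau>"
    using sorted[OF \<sigma>(2)] sorted[OF \<tau>(2)] set[OF \<sigma>(1)] set[OF \<tau>(1)]
    by (intro strict_sorted_equal) auto
  then have eq: "x (\<sigma> i) = x (\<tau> i)" if "i \<in> {1..N}" for i
    using that by (auto simp: L_def simp del: upt_Suc)
  have "distinct (L \<sigma>)"
    using sorted[OF \<sigma>(2)] strict_sorted_iff by blast
  then have "inj_on (x \<circ> \<sigma>) {1..N}"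
    by (simp add: L_def distinct_map comp_def atLeastLessThanSuc_atLeastAtMost del: upt_Suc)
  then have "inj_on x {1..N}"
    using inj_on_imageI[of x \<sigma> "{1..N}"] permutes_image[OF \<sigma>(1)] by simp
  then have "\<sigma> i = \<tau> i" if "i \<in> {1..N}" for i
    using eq[OF that] permutes_in_image[OF \<sigma>(1)] permutes_in_image[OF \<tau>(1)] that
    by (meson inj_onD)
  then show ?thesis
    using \<sigma>(1) \<tau>(1) by (metis ext permutes_not_in)
qed

text \<open>Distinct permutations select disjoint sets of positions. Only an inequality holds in
  general, since positions with tied entries belong to none of them.\<close>

lemma sum_card_ordered_positions_le:
  assumes "N \<ge> 1"
  shows "(\<Sum>\<sigma> | \<sigma> permutes {1..N}. card (ordered_positions N v p \<sigma>)) \<le> p ^ 2"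
proof -
  have sub: "ordered_positions N v p \<sigma> \<subseteq> {0..<int p} \<times> {0..<int p}" for \<sigma>
    using admissible_positions_subset[OF assms] by (auto simp: ordered_positions_def)
  have "(\<Sum>\<sigma> | \<sigma> permutes {1..N}. card (ordered_positions N v p \<sigma>))
      = card (\<Union>\<sigma>\<in>{\<sigma>. \<sigma> permutes {1..N}}. ordered_positions N v p \<sigma>)"
  proof (rule card_UN_disjoint[symmetric])
    show "finite {\<sigma>. \<sigma> permutes {1..N}}"
      by (simp add: finite_permutations)
    show "\<forall>\<sigma>\<in>{\<sigma>. \<sigma> permutes {1..N}}. finite (ordered_positions N v p \<sigma>)"
      using finite_subset[OF sub] by simp
    show "\<forall>\<sigma>\<in>{\<sigma>. \<sigma> permutes {1..N}}. \<forall>\<tau>\<in>{\<sigma>. \<sigma> permutes {1..N}}. \<sigma> \<noteq> \<tau> \<longrightarrow>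
        ordered_positions N v p \<sigma> \<inter> ordered_positions N v p \<tau> = {}"
      using sorting_permutation_unique by (fastforce simp: ordered_positions_def order_simplex_def)
  qed
  also have "\<dots> \<le> card ({0..<int p} \<times> {0..<int p})"
    using sub by (intro card_mono) auto
  also have "\<dots> = p ^ 2"
    by (simp add: card_cartesian_product power2_eq_square)
  finally show ?thesis .
qed

theorem theorem2:
  fixes N :: nat and M :: int
  assumes "N \<ge> 1"
  shows "\<exists>C::real. \<forall>v :: nat \<Rightarrow> int \<times> int.
    inj_on (\<lambda>j. snd (v j)) {1..N} \<and> M = Max ((\<lambda>j. sup_norm (v j)) ` {1..N}) \<longrightarrow>
    (\<forall>(p::nat) \<sigma>. prime p \<and> \<sigma> permutes {1..N} \<longrightarrow>
      \<bar>real (card {(a, b) \<in> admissible_positions N v p.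
                    pattern_point N v p a b \<in> order_simplex \<sigma> N})
        - real p ^ 2 / fact N\<bar>
      \<le> C * (real p powr (real (2 * N + 1) / real (N + 1))
              * ln (real p) powr (real N / real (N + 1))))"
proof -
  define D where "D = 4 * real_of_int M + 1 + 3 * real N ^ 2 + real N"
  \<comment> \<open>In the constant, \<open>fact N\<close> collects the deficits of all
    permutations, and 2 pays for the logarithmic factor, which is bounded below by 1/2.\<close>
  have "\<bar>real (card (ordered_positions N v p \<sigma>)) - real p ^ 2 / fact N\<bar>
      \<le> (2 * fact N * D) * (real p powr (real (2 * N + 1) / real (N + 1))
        * ln (real p) powr (real N / real (N + 1)))"
    if inj: "inj_on (\<lambda>j. snd (v j)) {1..N}" and Max: "M = Max ((\<lambda>j. sup_norm (v j)) ` {1..N})"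
      and p: "prime p" and \<sigma>: "\<sigma> permutes {1..N}" for v :: "nat \<Rightarrow> int \<times> int" and p \<sigma>
  proof -
    have sup: "sup_norm (v j) \<le> M" if "j \<in> {1..N}" for j
      unfolding Max using that by (intro Max_ge) auto
    then have v: "\<bar>fst (v j)\<bar> \<le> M \<and> \<bar>snd (v j)\<bar> \<le> M" if "j \<in> {1..N}" for j
      using that by (auto simp: sup_norm_def)
    have M: "M \<ge> 0"
      using v[of 1] assms by auto
    then have D: "D \<ge> 0"
      by (simp add: D_def)
    define h where "h = real p powr (real (2 * N + 1) / real (N + 1))"
    define l where "l = ln (real p) powr (real N / real (N + 1))"
    have lower: "real p ^ 2 / fact N - D * h \<le> real (card (ordered_positions N v p \<tau>))"
      if "\<tau> permutes {1..N}" for \<tau>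
      unfolding D_def h_def using card_ordered_positions_ge[OF v inj M p that assms] .
    define perms where "perms = {\<tau>. \<tau> permutes {1..N}}"
    have perms: "finite perms" "card perms = fact N" "\<sigma> \<in> perms"
      using \<sigma> by (auto simp: perms_def finite_permutations card_permutations)
    \<comment> \<open>Upper bound by complement: the other \<open>N! - 1\<close> permutations
      already claim their share of the \<open>p^2\<close> positions.\<close>
    have "real (card (ordered_positions N v p \<sigma>)) + (fact N - 1) * (real p ^ 2 / fact N - D * h)
        \<le> real (card (ordered_positions N v p \<sigma>))
          + (\<Sum>\<tau>\<in>perms - {\<sigma>}. real (card (ordered_positions N v p \<tau>)))"
    proof -
      have "(\<Sum>\<tau>\<in>perms - {\<sigma>}. real p ^ 2 / fact N - D * h)
          \<le> (\<Sum>\<tau>\<in>perms - {\<sigma>}. real (card (ordered_positions N v p \<tau>)))"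
        by (intro sum_mono lower) (simp add: perms_def)
      moreover have "real (card (perms - {\<sigma>})) = fact N - 1"
        using perms by (simp add: of_nat_diff fact_ge_1)
      ultimately show ?thesis
        by simp
    qed
    also have "\<dots> = real (\<Sum>\<tau>\<in>perms. card (ordered_positions N v p \<tau>))"
      using perms by (simp add: sum.remove[of perms \<sigma>])
    also have "\<dots> \<le> real (p ^ 2)"
      unfolding of_nat_le_iff perms_def by (rule sum_card_ordered_positions_le[OF assms])
    also have "real (p ^ 2) = real p ^ 2 / fact N + (fact N - 1) * (real p ^ 2 / fact N)"
      by (simp add: field_simps)
    finally have "real (card (ordered_positions N v p \<sigma>)) \<le> real p ^ 2 / fact N + (fact N - 1) * (D * h)"
      by (simp add: algebra_simps)
    moreover have "(fact N - 1) * (D * h) \<le> fact N * (D * h)" "1 * (D * h) \<le> fact N * (D * h)"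
      using D by (intro mult_right_mono; simp add: h_def fact_ge_1)+
    ultimately have "\<bar>real (card (ordered_positions N v p \<sigma>)) - real p ^ 2 / fact N\<bar> \<le> fact N * (D * h)"
      using lower[OF \<sigma>] by linarith
    \<comment> \<open>The bound so far has no logarithm; the logarithmic factor enters only by
      weakening it.\<close>
    also have "\<dots> = (2 * fact N * D * h) * (1 / 2)"
      by simp
    also have "\<dots> \<le> (2 * fact N * D * h) * l"
    proof (rule mult_left_mono)
      \<comment> \<open>As \<open>p\<close> is at least 2, \<open>ln p\<close> is at least 1/2, and
        a power with exponent in \<open>[0, 1]\<close> stays at least 1/2.\<close>
      have "exp (1 / 2) \<le> real p"
        using exp_half_le2 prime_ge_2_nat[OF p] by linarith
      then have ln: "1 / 2 \<le> ln (real p)"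
        using prime_gt_0_nat[OF p] ln_ge_iff[of "real p" "1 / 2"] by simp
      have "1 / 2 = (1 / 2 :: real) powr 1"
        by simp
      also have "\<dots> \<le> (1 / 2) powr (real N / real (N + 1))"
        by (rule powr_mono') auto
      also have "\<dots> \<le> l"
        unfolding l_def using ln by (intro powr_mono2) auto
      finally show "1 / 2 \<le> l" .
      show "0 \<le> 2 * fact N * D * h"
        using D by (simp add: h_def)
    qed
    finally show ?thesis
      by (simp add: h_def l_def mult.assoc)
  qed
  then show ?thesis
    unfolding ordered_positions_def by blast
qed

end
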